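(* Let $n\ge 1$, let $\mathscr{A},\mathscr{B}\subseteq\mathbb{N}^n$ be finite sets, let $\gamma\in\mathbb{N}^n$, and let $c_{\alpha}>0$ for $\alpha\in\mathscr{A}$ and $d_{\beta}>0$ for $\beta\in\mathscr{B}$ be real numbers. Let $\Delta=\mathrm{conv}(\mathscr{A})$ and suppose $\mathscr{B}\cup\{\gamma\}\subseteq\Delta^{\circ}\cap\mathbb{N}^n$. Assume that $\dim(\Delta)=n$ and that $\Delta$ is simple at some vertex. Then the system of $n$ polynomial equations (written as one vector equation in $\mathbb{R}^n$) $$\sum_{\alpha\in\mathscr{A}}c_{\alpha}(\alpha-\gamma)\mathbf{x}^{\alpha}-\sum_{\beta\in\mathscr{B}}d_{\beta}(\beta-\gamma)\mathbf{x}^{\beta}=\mathbf{0}$$ has at least one positive real zero, i.e. a solution $\mathbf{x}\in\mathbb{R}_+^n$.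
   Context: $\mathbb{N}=\{0,1,2,\ldots\}$; $\mathbb{R}_+$ is the set of (strictly) positive real numbers. For $\alpha=(\alpha_1,\ldots,\alpha_n)$, $\mathbf{x}^{\alpha}=x_1^{\alpha_1}\cdots x_n^{\alpha_n}$. $\mathrm{conv}$ denotes convex hull, and for a polytope $P$, $P^{\circ}$ denotes its interior. A polytope $\Delta$ of dimension $d$ is called simple at a vertex $v$ of $\Delta$ if $v$ is the intersection of precisely $d$ edges of $\Delta$ (i.e. exactly $d$ edges of $\Delta$ contain $v$). *)

theory Defs
  imports "HOL-Analysis.Analysis"
begin

text \<open>Multi-indices are vectors of type \<^typ>\<open>nat ^ 'n\<close>; \<open>real_vec\<close> is the inclusion of
  \<open>\<nat>\<^sup>n\<close> into \<open>\<real>\<^sup>n\<close>.\<close>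

definition real_vec :: "nat ^ 'n \<Rightarrow> real ^ 'n" where
  "real_vec \<alpha> = (\<chi> i. real (\<alpha> $ i))"

definition monomial_at :: "real ^ 'n \<Rightarrow> nat ^ 'n \<Rightarrow> real" where
  "monomial_at x \<alpha> = (\<Prod>i\<in>UNIV. (x $ i) ^ (\<alpha> $ i))"

text \<open>The vertices of a polytope are its extreme points and its edges are its one-dimensional
  faces, the polytope itself included if it is a segment. A polytope has finitely many faces,
  so the cardinality below is never that of an infinite set.\<close>

definition simple_at :: "'a::euclidean_space set \<Rightarrow> 'a \<Rightarrow> bool" where
  "simple_at P v \<longleftrightarrow>
     polytope P \<and> v extreme_point_of P \<and> int (card {e. e edge_of P \<and> v \<in> e}) = aff_dim P"

end

theory Submission
  imports Defs
begin

text \<open>The equation says that a signed exponential sum has a critical point. Put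
  \<open>x\<^sub>i = exp y\<^sub>i\<close>, so that the monomial \<open>x\<close> to the power \<open>\<alpha>\<close> becomes \<open>exp (\<alpha> \<bullet> y)\<close>, and let
  \<open>F y = (\<Sum>\<alpha>\<in>A. c \<alpha> * exp ((\<alpha> - \<gamma>) \<bullet> y)) - (\<Sum>\<beta>\<in>B. d \<beta> * exp ((\<beta> - \<gamma>) \<bullet> y))\<close>.
  The gradient of \<open>F\<close> at \<open>y\<close> is the left-hand side of the system at \<open>x\<close>, divided by the positive
  number \<open>exp (\<gamma> \<bullet> y)\<close>. It thus suffices that \<open>F\<close> attains a minimum.

  This holds because \<open>F\<close> is coercive. Balls of a common radius \<open>\<epsilon>\<close> around \<open>\<gamma>\<close> and around the finitely
  many \<open>\<beta>\<close> lie in the convex hull of \<open>A\<close>. Hence in each direction some \<open>\<alpha> \<in> A\<close> satisfies both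
  \<open>(\<alpha> - \<gamma>) \<bullet> y \<ge> \<epsilon> * norm y\<close> and \<open>(\<alpha> - \<beta>) \<bullet> y \<ge> \<epsilon> * norm y\<close> for all \<open>\<beta> \<in> B\<close>
  (\<open>dominating_point\<close>), and the term of this \<open>\<alpha>\<close> outgrows all the negative terms
  (\<open>signed_exp_sum_coercive\<close>).\<close>

text \<open>A linear functional attains its maximum over the convex hull of \<open>S\<close> at a point of \<open>S\<close>, and
  that maximum exceeds the values at interior points, uniformly on a finite set of these.\<close>

lemma dominating_point:
  fixes S P :: "'a::euclidean_space set"
  assumes "finite S" "S \<noteq> {}" "finite P" "P \<subseteq> interior (convex hull S)"
  obtains \<epsilon> where "\<epsilon> > 0" "\<And>y. \<exists>s\<in>S. \<forall>p\<in>P. p \<bullet> y + \<epsilon> * norm y \<le> s \<bullet> y"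
proof -
  have "\<exists>\<epsilon>>0. \<forall>p\<in>P. cball p \<epsilon> \<subseteq> convex hull S"
    using assms(3,4)
  proof (induction P rule: finite_induct)
    case empty
    show ?case by (auto intro: exI[of _ 1])
  next
    case (insert p P)
    then obtain \<epsilon> where \<epsilon>: "\<epsilon> > 0" "\<forall>q\<in>P. cball q \<epsilon> \<subseteq> convex hull S" by auto
    obtain \<delta> where \<delta>: "\<delta> > 0" "cball p \<delta> \<subseteq> convex hull S"
      using insert.prems by (auto simp: mem_interior_cball)
    have "cball q (min \<epsilon> \<delta>) \<subseteq> convex hull S" if "q \<in> insert p P" for q
    proof -
      have "cball q (min \<epsilon> \<delta>) \<subseteq> cball q \<epsilon>" "cball q (min \<epsilon> \<delta>) \<subseteq> cball q \<delta>"
        by (auto intro: subset_cball)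
      then show ?thesis using that \<epsilon>(2) \<delta>(2) by blast
    qed
    then show ?case using \<epsilon>(1) \<delta>(1) by (intro exI[of _ "min \<epsilon> \<delta>"]) auto
  qed
  then obtain \<epsilon> where \<epsilon>: "\<epsilon> > 0" "\<And>p. p \<in> P \<Longrightarrow> cball p \<epsilon> \<subseteq> convex hull S" by blast
  have "\<exists>s\<in>S. \<forall>p\<in>P. p \<bullet> y + \<epsilon> * norm y \<le> s \<bullet> y" for y
  proof -
    obtain s where s: "s \<in> S" "\<And>t. t \<in> S \<Longrightarrow> t \<bullet> y \<le> s \<bullet> y"
    proof -
      have "Max ((\<lambda>t. t \<bullet> y) ` S) \<in> (\<lambda>t. t \<bullet> y) ` S"
        using assms(1,2) by (intro Max_in) auto
      then obtain s where "s \<in> S" "Max ((\<lambda>t. t \<bullet> y) ` S) = s \<bullet> y" by auto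
      then show thesis using that assms(1) by (metis Max_ge finite_imageI imageI)
    qed
    have "convex hull S \<subseteq> {z. y \<bullet> z \<le> s \<bullet> y}"
      using s(2) by (intro hull_minimal convex_halfspace_le) (auto simp: inner_commute)
    moreover have "p + \<epsilon> *\<^sub>R sgn y \<in> convex hull S" if "p \<in> P" for p
    proof -
      have "p + \<epsilon> *\<^sub>R sgn y \<in> cball p \<epsilon>"
        using \<epsilon>(1) by (simp add: dist_norm norm_sgn)
      then show ?thesis using \<epsilon>(2)[OF that] by blast
    qed
    ultimately have "y \<bullet> (p + \<epsilon> *\<^sub>R sgn y) \<le> s \<bullet> y" if "p \<in> P" for p
      using that by blast
    moreover have "y \<bullet> sgn y = norm y"
      by (cases "y = 0") (simp_all add: sgn_div_norm dot_square_norm power2_eq_square)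
    ultimately have "\<forall>p\<in>P. p \<bullet> y + \<epsilon> * norm y \<le> s \<bullet> y"
      by (simp add: inner_add_right inner_commute)
    then show ?thesis using s(1) by blast
  qed
  then show thesis using that \<epsilon>(1) by blast
qed

text \<open>The exponential sum with exponents \<open>a i - g\<close> and coefficients \<open>c i\<close>, for \<open>i\<close> in the index set
  \<open>I\<close>. A signed sum is written as a difference of two of these.\<close>

definition exp_sum :: "'i set \<Rightarrow> ('i \<Rightarrow> real) \<Rightarrow> ('i \<Rightarrow> 'a) \<Rightarrow> 'a \<Rightarrow> 'a::euclidean_space \<Rightarrow> real" where
  "exp_sum I c a g y = (\<Sum>i\<in>I. c i * exp ((a i - g) \<bullet> y))"

lemma exp_sum_has_derivative:
  "(exp_sum I c a g has_derivative
     (\<lambda>h. (\<Sum>i\<in>I. (c i * exp ((a i - g) \<bullet> y)) *\<^sub>R (a i - g)) \<bullet> h)) (at y)"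
  unfolding exp_sum_def
  by (auto intro!: derivative_eq_intros simp: inner_sum_left algebra_simps fun_eq_iff sum_distrib_left)

lemma continuous_on_exp_sum: "continuous_on S (exp_sum I c a g)"
  unfolding exp_sum_def by (intro continuous_intros)

lemma signed_exp_sum_coercive:
  fixes a :: "'i \<Rightarrow> 'a::euclidean_space" and b :: "'j \<Rightarrow> 'a"
  assumes "finite I" "finite J"
    and c: "\<And>i. i \<in> I \<Longrightarrow> c i > 0" and d: "\<And>j. j \<in> J \<Longrightarrow> d j \<ge> 0"
    and int: "insert g (b ` J) \<subseteq> interior (convex hull (a ` I))"
  obtains R where "R > 0" "\<And>y. norm y \<ge> R \<Longrightarrow> exp_sum I c a g y - exp_sum J d b g y \<ge> K"
proof -
  have "I \<noteq> {}" using int by auto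
  obtain \<epsilon> where \<epsilon>: "\<epsilon> > 0"
    "\<And>y. \<exists>s\<in>a ` I. \<forall>p\<in>insert g (b ` J). p \<bullet> y + \<epsilon> * norm y \<le> s \<bullet> y"
    using dominating_point[OF _ _ _ int] \<open>finite I\<close> \<open>finite J\<close> \<open>I \<noteq> {}\<close> by auto
  define m where "m = Min (c ` I)"
  define D where "D = sum d J"
  have m: "m > 0" "\<And>i. i \<in> I \<Longrightarrow> m \<le> c i"
    using \<open>finite I\<close> \<open>I \<noteq> {}\<close> c by (auto simp: m_def)
  have "D \<ge> 0" unfolding D_def by (intro sum_nonneg d)
  \<comment> \<open>For \<open>norm y \<ge> R\<close> this makes \<open>m * exp (\<epsilon> * norm y) - D \<ge> \<bar>K\<bar>\<close>, because \<open>exp t \<ge> t\<close>.\<close>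
  define R where "R = (D + \<bar>K\<bar> + 1) / (m * \<epsilon>)"
  have "R > 0" unfolding R_def using \<open>D \<ge> 0\<close> m(1) \<epsilon>(1) by simp
  moreover have "exp_sum I c a g y - exp_sum J d b g y \<ge> K" if y: "norm y \<ge> R" for y
  proof -
    obtain i where i: "i \<in> I" "\<forall>p\<in>insert g (b ` J). p \<bullet> y + \<epsilon> * norm y \<le> a i \<bullet> y"
      using \<epsilon>(2)[of y] by auto
    define t where "t = \<epsilon> * norm y"
    define M where "M = (a i - g) \<bullet> y"
    have M: "t \<le> M" "\<And>j. j \<in> J \<Longrightarrow> (b j - g) \<bullet> y \<le> M - t"
      using i(2) by (auto simp: M_def t_def inner_diff_left)
    have "c i * exp M \<le> exp_sum I c a g y"
      unfolding exp_sum_def M_def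
      by (rule member_le_sum) (use i \<open>finite I\<close> c in \<open>auto intro: less_imp_le\<close>)
    moreover have "m * exp M \<le> c i * exp M" using m(2)[OF i(1)] by simp
    moreover have "exp_sum J d b g y \<le> D * exp (M - t)"
      unfolding exp_sum_def D_def sum_distrib_right
      by (intro sum_mono mult_left_mono) (use M(2) d in auto)
    moreover have "m * exp M - D * exp (M - t) = (m * exp t - D) * exp (M - t)"
      by (simp add: algebra_simps flip: exp_add)
    moreover have "m * exp t - D \<ge> \<bar>K\<bar>"
    proof -
      have "D + \<bar>K\<bar> + 1 = m * (\<epsilon> * R)" using m(1) \<epsilon>(1) by (simp add: R_def)
      also have "\<dots> \<le> m * t" unfolding t_def using y m(1) \<epsilon>(1) by (intro mult_left_mono) auto
      also have "\<dots> \<le> m * exp t" using m(1) exp_ge_add_one_self[of t] by (intro mult_left_mono) linarith+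
      finally show ?thesis by linarith
    qed
    moreover have "\<bar>K\<bar> * 1 \<le> (m * exp t - D) * exp (M - t)"
      using calculation(5) M(1) by (intro mult_mono) auto
    ultimately show ?thesis by linarith
  qed
  ultimately show thesis using that by blast
qed

text \<open>By coercivity the signed sum has a global minimum; the point \<open>y\<close> is a minimizer, and the equation
  says that the gradient vanishes there.\<close>

lemma signed_exp_sum_critical_point:
  fixes a :: "'i \<Rightarrow> 'a::euclidean_space" and b :: "'j \<Rightarrow> 'a"
  assumes "finite I" "finite J"
    and "\<And>i. i \<in> I \<Longrightarrow> c i > 0" and "\<And>j. j \<in> J \<Longrightarrow> d j \<ge> 0"
    and "insert g (b ` J) \<subseteq> interior (convex hull (a ` I))"
  obtains y where "(\<Sum>i\<in>I. (c i * exp ((a i - g) \<bullet> y)) *\<^sub>R (a i - g)) -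
    (\<Sum>j\<in>J. (d j * exp ((b j - g) \<bullet> y)) *\<^sub>R (b j - g)) = 0"
proof -
  define F where "F y = exp_sum I c a g y - exp_sum J d b g y" for y
  obtain R where R: "R > 0" "\<And>y. norm y \<ge> R \<Longrightarrow> F y \<ge> F 0"
    using signed_exp_sum_coercive[where c = c and d = d and K = "F 0", OF assms] unfolding F_def by blast
  have "continuous_on (cball 0 R) F"
    unfolding F_def by (intro continuous_intros continuous_on_exp_sum)
  then obtain y where y: "\<And>z. z \<in> cball 0 R \<Longrightarrow> F y \<le> F z"
    using continuous_attains_inf[of "cball 0 R" F] R(1)
    by (metis cball_eq_empty compact_cball not_less_iff_gr_or_eq)
  have min: "F y \<le> F z" for z
    using y[of z] y[of 0] R(1) R(2)[of z] by (cases "norm z \<le> R") auto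
  define G where "G = (\<Sum>i\<in>I. (c i * exp ((a i - g) \<bullet> y)) *\<^sub>R (a i - g)) -
    (\<Sum>j\<in>J. (d j * exp ((b j - g) \<bullet> y)) *\<^sub>R (b j - g))"
  have "(F has_derivative (\<lambda>h. G \<bullet> h)) (at y)"
    unfolding F_def G_def inner_diff_left[of "sum _ _"]
    by (intro has_derivative_diff exp_sum_has_derivative)
  then have "(\<lambda>h. G \<bullet> h) = (\<lambda>h. 0)"
    using differential_zero_maxmin[of y UNIV F] min by auto
  then have "G \<bullet> G = 0" by metis
  then show thesis using that[of y] by (simp add: G_def)
qed

lemma monomial_at_exp: "monomial_at (\<chi> i. exp (y $ i)) \<alpha> = exp (real_vec \<alpha> \<bullet> y)"
  by (simp add: monomial_at_def real_vec_def inner_vec_def exp_sum flip: exp_of_nat_mult)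

theorem theorem4p10:
  fixes A B :: "(nat ^ 'n) set"
    and \<gamma> :: "nat ^ 'n"
    and c d :: "nat ^ 'n \<Rightarrow> real"
    and \<Delta> :: "(real ^ 'n) set"
  assumes "finite A" and "finite B"
    and "\<And>\<alpha>. \<alpha> \<in> A \<Longrightarrow> c \<alpha> > 0"
    and "\<And>\<beta>. \<beta> \<in> B \<Longrightarrow> d \<beta> > 0"
    and "\<Delta> = convex hull (real_vec ` A)"
    and "real_vec ` (B \<union> {\<gamma>}) \<subseteq> interior \<Delta>"
    and "aff_dim \<Delta> = int CARD('n)"
    and "\<exists>v. simple_at \<Delta> v"
  shows "\<exists>x :: real ^ 'n. (\<forall>i. x $ i > 0) \<and>
    (\<Sum>\<alpha>\<in>A. (c \<alpha> * monomial_at x \<alpha>) *\<^sub>R (real_vec \<alpha> - real_vec \<gamma>)) -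
    (\<Sum>\<beta>\<in>B. (d \<beta> * monomial_at x \<beta>) *\<^sub>R (real_vec \<beta> - real_vec \<gamma>)) = 0"
proof -
  have "insert (real_vec \<gamma>) (real_vec ` B) \<subseteq> interior (convex hull (real_vec ` A))"
    using assms(5,6) by auto
  then obtain y where y: "(\<Sum>\<alpha>\<in>A. (c \<alpha> * exp ((real_vec \<alpha> - real_vec \<gamma>) \<bullet> y)) *\<^sub>R (real_vec \<alpha> - real_vec \<gamma>)) -
    (\<Sum>\<beta>\<in>B. (d \<beta> * exp ((real_vec \<beta> - real_vec \<gamma>) \<bullet> y)) *\<^sub>R (real_vec \<beta> - real_vec \<gamma>)) = 0"
    using signed_exp_sum_critical_point[of A B c d "real_vec \<gamma>" real_vec real_vec] assms(1-4)
    by (metis less_imp_le)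
  define x where "x = (\<chi> i. exp (y $ i))"
  have scale: "(\<Sum>\<alpha>\<in>S. (e \<alpha> * monomial_at x \<alpha>) *\<^sub>R (real_vec \<alpha> - real_vec \<gamma>)) =
    exp (real_vec \<gamma> \<bullet> y) *\<^sub>R
      (\<Sum>\<alpha>\<in>S. (e \<alpha> * exp ((real_vec \<alpha> - real_vec \<gamma>) \<bullet> y)) *\<^sub>R (real_vec \<alpha> - real_vec \<gamma>))"
    for S :: "(nat ^ 'n) set" and e
    unfolding scaleR_sum_right
  proof (rule sum.cong[OF refl])
    fix \<alpha>
    have "monomial_at x \<alpha> = exp (real_vec \<gamma> \<bullet> y) * exp ((real_vec \<alpha> - real_vec \<gamma>) \<bullet> y)"
      by (simp add: x_def monomial_at_exp inner_diff_left flip: exp_add)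
    then show "(e \<alpha> * monomial_at x \<alpha>) *\<^sub>R (real_vec \<alpha> - real_vec \<gamma>) = exp (real_vec \<gamma> \<bullet> y) *\<^sub>R
        (e \<alpha> * exp ((real_vec \<alpha> - real_vec \<gamma>) \<bullet> y)) *\<^sub>R (real_vec \<alpha> - real_vec \<gamma>)"
      by simp
  qed
  have "\<forall>i. x $ i > 0" by (simp add: x_def)
  then show ?thesis
    using y by (intro exI[of _ x]) (simp add: scale flip: scaleR_diff_right)
qed

end
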